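(* Let $M$ and $N$ be matroids on disjoint finite sets $S$ and $T$, and let $A,A'\subseteq S$ and $B,B'\subseteq T$. If $\mathrm{cl}_M(A)=\mathrm{cl}_M(A')$ and $\mathrm{cl}_{N^*}(B)=\mathrm{cl}_{N^*}(B')$, then $(M,N;A,B)=(M,N;A',B')$. Conversely, if $(M,N;A,B)\neq M\oplus N$ and $(M,N;A,B)=(M,N;A',B')$, then $\mathrm{cl}_M(A)=\mathrm{cl}_M(A')$ and $\mathrm{cl}_{N^*}(B)=\mathrm{cl}_{N^*}(B')$.
   Context: The principal sum $(M,N;A,B)$ is the matroid union $M^+(A,B)\vee N_0$, where: $N_0=N\oplus U_{0,S}$ ($N$ with the elements of $S$ added as loops); $M^+(A,B)$ is the matroid on $S\cup T$ obtained from $M$ by adding each element of $B$ freely (by successive principal extensions) to the flat $\mathrm{cl}_M(A)$ and each element of $T-B$ as a loop, equivalently the matroid with rank function $r(X\cup Y)=\min\{r_M(X\cup A),\,r_M(X)+|Y\cap B|\}$ for $X\subseteq S$, $Y\subseteq T$; and the matroid union $G\vee H$ of matroids on a common set has as independent sets the unions of an independent set of $G$ and an independent set of $H$. $\mathrm{cl}_{N^*}$ is closure in the dual matroid $N^*$. *)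

theory Defs
  imports Main
begin

record 'a indep_system =
  ground :: "'a set"
  indep :: "'a set set"

definition matroid :: "'a indep_system \<Rightarrow> bool" where
  "matroid M \<longleftrightarrow>
     finite (ground M) \<and>
     (\<forall>I\<in>indep M. I \<subseteq> ground M) \<and>
     {} \<in> indep M \<and>
     (\<forall>I\<in>indep M. \<forall>J. J \<subseteq> I \<longrightarrow> J \<in> indep M) \<and>
     (\<forall>I\<in>indep M. \<forall>J\<in>indep M. card I < card J \<longrightarrow> (\<exists>x\<in>J - I. insert x I \<in> indep M))"

definition matroid_rank :: "'a indep_system \<Rightarrow> 'a set \<Rightarrow> nat" where
  "matroid_rank M X = Max (card ` {I \<in> indep M. I \<subseteq> X})"

definition matroid_closure :: "'a indep_system \<Rightarrow> 'a set \<Rightarrow> 'a set" where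
  "matroid_closure M X = {e \<in> ground M. matroid_rank M (insert e X) = matroid_rank M X}"

definition basis :: "'a indep_system \<Rightarrow> 'a set \<Rightarrow> bool" where
  "basis M B \<longleftrightarrow> B \<in> indep M \<and> (\<forall>I\<in>indep M. B \<subseteq> I \<longrightarrow> I = B)"

text \<open>The bases of the dual are the complements of the bases.\<close>

definition dual_matroid :: "'a indep_system \<Rightarrow> 'a indep_system" where
  "dual_matroid M = \<lparr>ground = ground M, indep = {I. \<exists>B. basis M B \<and> I \<subseteq> ground M - B}\<rparr>"

definition uniform_matroid :: "nat \<Rightarrow> 'a set \<Rightarrow> 'a indep_system" where
  "uniform_matroid k E = \<lparr>ground = E, indep = {I. I \<subseteq> E \<and> card I \<le> k}\<rparr>"

text \<open>The direct sum is only meaningful for disjoint ground sets.\<close>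

definition direct_sum :: "'a indep_system \<Rightarrow> 'a indep_system \<Rightarrow> 'a indep_system" where
  "direct_sum M N =
     \<lparr>ground = ground M \<union> ground N,
      indep = {I. I \<subseteq> ground M \<union> ground N \<and> I \<inter> ground M \<in> indep M \<and> I \<inter> ground N \<in> indep N}\<rparr>"

text \<open>The matroid union is used for matroids on a common ground set.\<close>

definition matroid_union :: "'a indep_system \<Rightarrow> 'a indep_system \<Rightarrow> 'a indep_system" where
  "matroid_union G H =
     \<lparr>ground = ground G \<union> ground H, indep = {I \<union> J |I J. I \<in> indep G \<and> J \<in> indep H}\<rparr>"

text \<open>
  In the matroid on \<open>E\<close> with rank function \<open>r\<close>, a set is independent iff its
  rank equals its cardinality.
\<close>

definition matroid_of_rank :: "'a set \<Rightarrow> ('a set \<Rightarrow> nat) \<Rightarrow> 'a indep_system" where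
  "matroid_of_rank E r = \<lparr>ground = E, indep = {I. I \<subseteq> E \<and> r I = card I}\<rparr>"

text \<open>
  \<open>free_extension M T A B\<close> is $M^+(A,B)$ for a set \<open>T\<close> disjoint from the ground set of
  \<open>M\<close>: the elements of \<open>B\<close> are added freely to the flat spanned by \<open>A\<close>, those of
  \<open>T - B\<close> as loops.  A subset \<open>Z\<close> of the new ground set splits as $X \cup Y$ with
  \<open>X = Z \<inter> ground M\<close> and \<open>Y = Z \<inter> T\<close>.
\<close>

definition free_extension ::
    "'a indep_system \<Rightarrow> 'a set \<Rightarrow> 'a set \<Rightarrow> 'a set \<Rightarrow> 'a indep_system" where
  "free_extension M T A B =
     matroid_of_rank (ground M \<union> T)
       (\<lambda>Z. min (matroid_rank M ((Z \<inter> ground M) \<union> A)) (matroid_rank M (Z \<inter> ground M) + card ((Z \<inter> T) \<inter> B)))"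

definition principal_sum ::
    "'a indep_system \<Rightarrow> 'a indep_system \<Rightarrow> 'a set \<Rightarrow> 'a set \<Rightarrow> 'a indep_system" where
  "principal_sum M N A B =
     matroid_union (free_extension M (ground N) A B) (direct_sum N (uniform_matroid 0 (ground M)))"

end

theory Submission
  imports Defs
begin

text \<open>
  For \<open>X \<subseteq> S\<close> and \<open>Y \<subseteq> T\<close>, the set \<open>X \<union> Y\<close> is independent in $(M,N;A,B)$ iff \<open>X\<close> is
  independent in \<open>M\<close>, \<open>Y - B\<close> is independent in \<open>N\<close>, and the nullity of \<open>Y\<close> in \<open>N\<close> is at most
  $r_M(X\cup A)-|X|$.  The ranks $r_M(X\cup A)$ depend only on the closure of \<open>A\<close>.  An element
  \<open>e\<close> lies in the dual closure of \<open>B\<close> iff \<open>insert e Y - B\<close> is independent in \<open>N\<close> for every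
  independent \<open>Y\<close>; so this closure determines which sets \<open>Y - B\<close> are independent.
  Conversely, if the principal sum is not the direct sum, then \<open>A\<close> has positive rank, so every
  \<open>Y\<close> of nullity at most one with \<open>Y - B\<close> independent is visible in the principal sum, which gives
  back the dual closure of \<open>B\<close>.  Moreover there is such a \<open>Y\<close> of nullity exactly one, and it
  detects the independent sets of \<open>M\<close> that do not span \<open>A\<close>, which gives back the closure of \<open>A\<close>.
\<close>

section \<open>Rank and closure\<close>

context
  fixes M :: "'a indep_system"
  assumes matroid: "matroid M"
begin

lemma finite_ground: "finite (ground M)"
  using matroid by (simp add: matroid_def)

lemma indep_subset_ground: "I \<in> indep M \<Longrightarrow> I \<subseteq> ground M"
  using matroid by (simp add: matroid_def)

lemma indep_finite: "I \<in> indep M \<Longrightarrow> finite I"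
  using finite_ground indep_subset_ground finite_subset by blast

lemma empty_indep: "{} \<in> indep M"
  using matroid by (simp add: matroid_def)

lemma indep_subset: "I \<in> indep M \<Longrightarrow> J \<subseteq> I \<Longrightarrow> J \<in> indep M"
  using matroid by (simp add: matroid_def)

lemma augment:
  "I \<in> indep M \<Longrightarrow> J \<in> indep M \<Longrightarrow> card I < card J \<Longrightarrow> \<exists>x\<in>J - I. insert x I \<in> indep M"
  using matroid by (simp add: matroid_def)

lemma finite_indep_cards: "finite (card ` {I \<in> indep M. I \<subseteq> X})"
proof -
  have "{I \<in> indep M. I \<subseteq> X} \<subseteq> Pow (ground M)"
    using indep_subset_ground by blast
  then show ?thesis
    using finite_ground by (meson finite_Pow_iff finite_imageI finite_subset)
qed

lemma card_le_rank: "I \<in> indep M \<Longrightarrow> I \<subseteq> X \<Longrightarrow> card I \<le> matroid_rank M X"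
  unfolding matroid_rank_def using finite_indep_cards by (intro Max_ge) auto

lemma rank_attained: "\<exists>I\<in>indep M. I \<subseteq> X \<and> card I = matroid_rank M X"
proof -
  have "matroid_rank M X \<in> card ` {I \<in> indep M. I \<subseteq> X}"
    unfolding matroid_rank_def using finite_indep_cards empty_indep by (intro Max_in) auto
  then show ?thesis by auto
qed

lemma rank_mono: "X \<subseteq> Y \<Longrightarrow> matroid_rank M X \<le> matroid_rank M Y"
  using rank_attained[of X] card_le_rank by (metis subset_trans)

lemma rank_le_card: "finite X \<Longrightarrow> matroid_rank M X \<le> card X"
  using rank_attained[of X] card_mono by metis

lemma rank_indep: "I \<in> indep M \<Longrightarrow> matroid_rank M I = card I"
  using rank_le_card card_le_rank indep_finite by (simp add: le_antisym)

lemma indep_if_rank_eq_card: "finite X \<Longrightarrow> matroid_rank M X = card X \<Longrightarrow> X \<in> indep M"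
  using rank_attained[of X] card_subset_eq by metis

text \<open>A largest independent set between \<open>I\<close> and \<open>X\<close> already has full
  rank: otherwise augmenting it from a maximum independent subset of \<open>X\<close> would enlarge
  it.\<close>

lemma extend_to_basis:
  assumes "I \<in> indep M" and "I \<subseteq> X"
  obtains J where "J \<in> indep M" "I \<subseteq> J" "J \<subseteq> X" "card J = matroid_rank M X"
proof -
  let ?P = "\<lambda>J. J \<in> indep M \<and> I \<subseteq> J \<and> J \<subseteq> X"
  have bound: "\<forall>J. ?P J \<longrightarrow> card J \<le> matroid_rank M X"
    using card_le_rank by blast
  have "\<exists>J. ?P J \<and> (\<forall>K. ?P K \<longrightarrow> card K \<le> card J)"
    using ex_has_greatest_nat[of ?P I card "Suc (matroid_rank M X)"] assms bound
    by (simp add: less_Suc_eq_le)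
  then obtain J where J: "?P J" and max: "\<And>K. ?P K \<Longrightarrow> card K \<le> card J"
    by blast
  have "card J = matroid_rank M X"
  proof (rule ccontr)
    assume "card J \<noteq> matroid_rank M X"
    then have less: "card J < matroid_rank M X"
      using J bound by (simp add: le_neq_implies_less)
    obtain K where K: "K \<in> indep M" "K \<subseteq> X" "card K = matroid_rank M X"
      using rank_attained by blast
    then obtain x where x: "x \<in> K - J" "insert x J \<in> indep M"
      using J less augment by metis
    then have "?P (insert x J)"
      using J K by blast
    from max[OF this] show False
      using x J indep_finite by simp
  qed
  with J that show thesis by blast
qed

lemma rank_insert_le: "matroid_rank M (insert e X) \<le> Suc (matroid_rank M X)"
proof -
  obtain I where I: "I \<in> indep M" "I \<subseteq> insert e X" "card I = matroid_rank M (insert e X)"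
    using rank_attained by blast
  then have "card (I - {e}) \<le> matroid_rank M X"
    using indep_subset by (intro card_le_rank) auto
  then show ?thesis
    using I indep_finite[of I] by (simp add: card_Diff_singleton_if split: if_splits)
qed

section \<open>Closure and the ranks of unions\<close>

lemma subset_closure: "A \<subseteq> ground M \<Longrightarrow> A \<subseteq> matroid_closure M A"
  by (auto simp: matroid_closure_def insert_absorb)

text \<open>Bases are nested: \<open>I\<close> of \<open>A\<close>, then \<open>J\<close> of
  \<open>X \<union> A\<close>, then \<open>K\<close> of the whole union. An element of
  \<open>K - J\<close> would be independent of \<open>I\<close>, so it would raise the rank of
  \<open>A\<close>, although it lies in the closure of \<open>A\<close>.\<close>

lemma rank_union_closure:
  assumes "C \<subseteq> matroid_closure M A"
  shows "matroid_rank M (X \<union> A \<union> C) = matroid_rank M (X \<union> A)"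
proof (rule antisym)
  obtain I where I: "I \<in> indep M" "I \<subseteq> A" "card I = matroid_rank M A"
    using rank_attained by blast
  then obtain J where J: "J \<in> indep M" "I \<subseteq> J" "J \<subseteq> X \<union> A" "card J = matroid_rank M (X \<union> A)"
    using extend_to_basis[of I "X \<union> A"] by blast
  obtain K where K: "K \<in> indep M" "J \<subseteq> K" "K \<subseteq> X \<union> A \<union> C"
      "card K = matroid_rank M (X \<union> A \<union> C)"
    using extend_to_basis[of J "X \<union> A \<union> C"] J by blast
  have "K \<subseteq> J"
  proof
    fix e assume e: "e \<in> K"
    show "e \<in> J"
    proof (rule ccontr)
      assume "e \<notin> J"
      have J_ind: "insert e J \<in> indep M"
        using e K by (intro indep_subset[OF K(1)]) auto
      have I_ind: "insert e I \<in> indep M"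
        using J by (intro indep_subset[OF J_ind]) auto
      \<comment> \<open>\<open>J\<close> already has the full rank of \<open>X \<union> A\<close>,
        so \<open>e\<close> must come from \<open>C\<close>.\<close>
      have "card (insert e J) \<le> matroid_rank M (X \<union> A)" if "e \<in> X \<union> A"
        using that J J_ind by (intro card_le_rank) auto
      then have "e \<notin> X \<union> A"
        using \<open>e \<notin> J\<close> J indep_finite by auto
      then have "matroid_rank M (insert e A) = matroid_rank M A"
        using e K assms by (auto simp: matroid_closure_def)
      moreover have "card (insert e I) \<le> matroid_rank M (insert e A)"
        using I I_ind by (intro card_le_rank) auto
      ultimately show False
        using I \<open>e \<notin> J\<close> J indep_finite[of I] by (auto simp: card_insert_if split: if_splits)
    qed
  qed
  then show "matroid_rank M (X \<union> A \<union> C) \<le> matroid_rank M (X \<union> A)"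
    using J K by (simp add: subset_antisym)
qed (auto intro: rank_mono)

text \<open>Each of \<open>A\<close> and \<open>A'\<close> lies in the closure of the other, so both
  ranks equal that of \<open>X \<union> A \<union> A'\<close>.\<close>

lemma rank_union_eq_if_closure_eq:
  assumes "A \<subseteq> ground M" "A' \<subseteq> ground M" "matroid_closure M A = matroid_closure M A'"
  shows "matroid_rank M (X \<union> A) = matroid_rank M (X \<union> A')"
proof -
  have "matroid_rank M (X \<union> A) = matroid_rank M (X \<union> A \<union> A')"
    using rank_union_closure[of A' A X] subset_closure[of A'] assms by simp
  also have "\<dots> = matroid_rank M (X \<union> A')"
    using rank_union_closure[of A A' X] subset_closure[of A] assms by (simp add: Un_ac)
  finally show ?thesis .
qed

lemma closure_subset_if_rank_union_eq:
  assumes "A' \<subseteq> ground M" "matroid_rank M (A \<union> A') = matroid_rank M A"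
  shows "matroid_closure M A' \<subseteq> matroid_closure M A"
proof
  fix e assume e: "e \<in> matroid_closure M A'"
  have "matroid_rank M (insert e A) \<le> matroid_rank M (A \<union> A' \<union> {e})"
    by (rule rank_mono) auto
  also have "\<dots> = matroid_rank M A"
    using rank_union_closure[of "{e}" A' A] e assms by simp
  finally have "matroid_rank M (insert e A) = matroid_rank M A"
    using rank_mono[of A "insert e A"] by (simp add: subset_insertI)
  then show "e \<in> matroid_closure M A"
    using e by (simp add: matroid_closure_def)
qed

lemma basis_iff_card: "basis M I \<longleftrightarrow> I \<in> indep M \<and> card I = matroid_rank M (ground M)"
proof
  assume b: "basis M I"
  then obtain J where "J \<in> indep M" "I \<subseteq> J" "card J = matroid_rank M (ground M)"
    using extend_to_basis[of I "ground M"] indep_subset_ground unfolding basis_def by metis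
  with b show "I \<in> indep M \<and> card I = matroid_rank M (ground M)"
    unfolding basis_def by metis
next
  assume I: "I \<in> indep M \<and> card I = matroid_rank M (ground M)"
  have "J = I" if "J \<in> indep M" "I \<subseteq> J" for J
    using that I card_le_rank[of J "ground M"] indep_subset_ground indep_finite
    by (metis card_seteq)
  with I show "basis M I"
    unfolding basis_def by blast
qed

section \<open>Dual closure\<close>

text \<open>The classical formula for the dual rank, r*(B) = |B| + r(E - B) - r(E), with the
  subtracted term moved across to stay within the naturals.\<close>

lemma rank_dual:
  assumes B: "B \<subseteq> ground M"
  shows "matroid_rank (dual_matroid M) B + matroid_rank M (ground M)
    = card B + matroid_rank M (ground M - B)"
proof -
  let ?E = "ground M" and ?r = "matroid_rank M"
  let ?D = "{I \<in> indep (dual_matroid M). I \<subseteq> B}"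
  have finB: "finite B"
    using B finite_ground finite_subset by blast
  have split: "card (B - K) + ?r ?E = card B + card (K - B)" if "basis M K" for K
  proof -
    have K: "finite K" "card K = ?r ?E"
      using that basis_iff_card indep_finite by auto
    have "card B = card (B - K) + card (B \<inter> K)" "card K = card (K - B) + card (B \<inter> K)"
      using K finB card_Int_Diff[of B K] card_Int_Diff[of K B] by (auto simp: Int_commute)
    then show ?thesis
      using K by simp
  qed
  have upper: "card I + ?r ?E \<le> card B + ?r (?E - B)" if I: "I \<in> ?D" for I
  proof -
    obtain K where K: "basis M K" "I \<subseteq> ?E - K"
      using I by (auto simp: dual_matroid_def)
    have "card I \<le> card (B - K)"
      using I K finB by (intro card_mono) auto
    moreover have "card (K - B) \<le> ?r (?E - B)"
    proof (rule card_le_rank)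
      have K_ind: "K \<in> indep M"
        using K by (simp add: basis_def)
      show "K - B \<in> indep M"
        by (rule indep_subset[OF K_ind Diff_subset])
      show "K - B \<subseteq> ?E - B"
        using indep_subset_ground[OF K_ind] by blast
    qed
    ultimately show ?thesis
      using split[OF K(1)] by linarith
  qed
  \<comment> \<open>For the lower bound, a basis \<open>K\<close> with as many elements as possible
    outside \<open>B\<close> leaves \<open>B - K\<close> as large as possible.\<close>
  obtain I where I: "I \<in> indep M" "I \<subseteq> ?E - B" "card I = ?r (?E - B)"
    using rank_attained by blast
  obtain K where K: "K \<in> indep M" "I \<subseteq> K" "card K = ?r ?E"
    using extend_to_basis[of I ?E] I indep_subset_ground by metis
  have basis: "basis M K"
    using K basis_iff_card by blast
  have "card I \<le> card (K - B)"
    using I K indep_finite by (intro card_mono) auto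
  then have lower: "card B + ?r (?E - B) \<le> card (B - K) + ?r ?E"
    using split[OF basis] I by simp
  have mem: "B - K \<in> ?D"
    using B basis by (auto simp: dual_matroid_def)
  have fin: "finite (card ` ?D)"
    using finB by (intro finite_imageI) (auto intro: finite_subset[of _ "Pow B"])
  have "card (B - K) \<le> matroid_rank (dual_matroid M) B"
    unfolding matroid_rank_def using fin mem by (intro Max_ge) auto
  moreover have "matroid_rank (dual_matroid M) B \<in> card ` ?D"
    unfolding matroid_rank_def using fin mem by (intro Max_in) auto
  ultimately show ?thesis
    using upper lower by fastforce
qed

text \<open>For \<open>e\<close> outside \<open>B\<close>, the dual rank formula turns membership
  into the statement that \<open>e\<close> is a coloop of the restriction of \<open>M\<close> to the
  complement of \<open>B\<close>. This describes the dual closure by independence in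
  \<open>M\<close> alone.\<close>

lemma dual_closure_iff:
  assumes B: "B \<subseteq> ground M"
  shows "e \<in> matroid_closure (dual_matroid M) B \<longleftrightarrow>
    e \<in> ground M \<and> (\<forall>Y\<in>indep M. insert e Y - B \<in> indep M)"
proof (cases "e \<in> ground M - B")
  case False
  then show ?thesis
    using B indep_subset
    by (auto simp: matroid_closure_def dual_matroid_def insert_absorb insert_Diff_if)
next
  case True
  let ?r = "matroid_rank M"
  let ?R = "ground M - insert e B"
  have R: "insert e ?R = ground M - B"
    using True by auto
  have finB: "finite B"
    using B finite_ground finite_subset by blast
  have "e \<in> matroid_closure (dual_matroid M) B \<longleftrightarrow> ?r (ground M - B) = Suc (?r ?R)"
    using rank_dual[OF B] rank_dual[of "insert e B"] True B finB
    by (auto simp: matroid_closure_def dual_matroid_def)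
  also have "\<dots> \<longleftrightarrow> (\<forall>Y\<in>indep M. insert e Y - B \<in> indep M)"
  proof
    assume rank: "?r (ground M - B) = Suc (?r ?R)"
    show "\<forall>Y\<in>indep M. insert e Y - B \<in> indep M"
    proof
      fix Y assume Y: "Y \<in> indep M"
      have "Y - insert e B \<in> indep M" "Y - insert e B \<subseteq> ?R"
        using Y indep_subset indep_subset_ground by blast+
      then obtain J where J: "J \<in> indep M" "Y - insert e B \<subseteq> J" "J \<subseteq> ?R" "card J = ?r ?R"
        by (rule extend_to_basis)
      obtain K where K: "K \<in> indep M" "J \<subseteq> K" "K \<subseteq> ground M - B" "card K = ?r (ground M - B)"
        using extend_to_basis[of J "ground M - B"] J by blast
      \<comment> \<open>\<open>K\<close> is too large to fit into \<open>?R\<close>, hence contains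
        \<open>e\<close>; it also contains \<open>Y - insert e B\<close> through
        \<open>J\<close>.\<close>
      have "\<not> K \<subseteq> ?R"
        using K rank card_le_rank[of K ?R] by auto
      then have "insert e Y - B \<subseteq> K"
        using J K by auto
      then show "insert e Y - B \<in> indep M"
        using K indep_subset by blast
    qed
  next
    assume *: "\<forall>Y\<in>indep M. insert e Y - B \<in> indep M"
    obtain J where J: "J \<in> indep M" "J \<subseteq> ?R" "card J = ?r ?R"
      using rank_attained by blast
    have "insert e J - B = insert e J"
      using J True by auto
    then have "insert e J \<in> indep M"
      using * J by metis
    then have "card (insert e J) \<le> ?r (ground M - B)"
      using J True by (intro card_le_rank) auto
    moreover have "card (insert e J) = Suc (?r ?R)"
      using J indep_finite by (auto simp: card_insert_if)
    ultimately show "?r (ground M - B) = Suc (?r ?R)"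
      using rank_insert_le[of e ?R] R by simp
  qed
  finally show ?thesis
    using True by blast
qed

text \<open>The elements of the dual closure can be put back one at a time without losing
  independence outside \<open>B\<close>. Hence the condition on \<open>Y - B\<close> depends only on
  the dual closure of \<open>B\<close>.\<close>

lemma indep_diff_dual_closure_iff:
  assumes B: "B \<subseteq> ground M"
  shows "Y - matroid_closure (dual_matroid M) B \<in> indep M \<longleftrightarrow> Y - B \<in> indep M"
proof
  let ?C = "matroid_closure (dual_matroid M) B"
  have BC: "B \<subseteq> ?C"
    using B by (auto simp: matroid_closure_def dual_matroid_def insert_absorb)
  show "Y - ?C \<in> indep M" if "Y - B \<in> indep M"
    using that BC indep_subset by blast
  assume ind: "Y - ?C \<in> indep M"
  have "?C \<subseteq> ground M"
    using dual_closure_iff[OF B] by blast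
  then have fin: "finite (Y \<inter> ?C)"
    using finite_ground finite_subset by blast
  have "(Y - ?C) \<union> D - B \<in> indep M" if "finite D" "D \<subseteq> ?C" for D
    using that
  proof (induction D rule: finite_induct)
    case empty
    then show ?case
      using ind indep_subset by auto
  next
    case (insert e D)
    then have "insert e (Y - ?C \<union> D - B) - B \<in> indep M"
      using dual_closure_iff[OF B] by blast
    moreover have "insert e (Y - ?C \<union> D - B) - B = (Y - ?C) \<union> insert e D - B"
      by auto
    ultimately show ?case by simp
  qed
  from this[OF fin] show "Y - B \<in> indep M"
    by (metis Int_lower2 Un_Diff_Int)
qed

end

section \<open>Independent sets of the principal sum\<close>

text \<open>The second term of the minimum is at most \<open>card Z\<close>, with equality iff the
  part in \<open>M\<close> is independent and the part in \<open>T\<close> lies in \<open>B\<close>.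
  The first term then only has to be at least \<open>card Z\<close>.\<close>

lemma indep_free_extension:
  assumes M: "matroid M" and T: "finite T" and disj: "ground M \<inter> T = {}"
  shows "Z \<in> indep (free_extension M T A B) \<longleftrightarrow>
    Z \<subseteq> ground M \<union> T \<and> Z \<inter> ground M \<in> indep M \<and> Z \<inter> T \<subseteq> B \<and>
    card Z \<le> matroid_rank M (Z \<inter> ground M \<union> A)"
proof (cases "Z \<subseteq> ground M \<union> T")
  case True
  let ?X = "Z \<inter> ground M" and ?Y = "Z \<inter> T"
  have fin: "finite ?X" "finite ?Y"
    using finite_ground[OF M] T by auto
  have Z: "card Z = card ?X + card ?Y"
    using card_Un_disjoint[OF fin] True disj by (metis Int_Un_distrib Int_absorb2 Int_assoc
        Int_empty_left inf_commute)
  have X: "matroid_rank M ?X \<le> card ?X" "matroid_rank M ?X = card ?X \<longleftrightarrow> ?X \<in> indep M"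
    using rank_le_card[OF M fin(1)] indep_if_rank_eq_card[OF M fin(1)] rank_indep[OF M] by auto
  have Y: "card (?Y \<inter> B) \<le> card ?Y" "card (?Y \<inter> B) = card ?Y \<longleftrightarrow> ?Y \<subseteq> B"
    using fin(2) by (auto intro: card_mono simp: Int_absorb2) (metis card_subset_eq Int_iff inf_le1)
  show ?thesis
    using True X Y Z unfolding free_extension_def matroid_of_rank_def
    by (auto simp: min_def split: if_splits)
qed (simp add: free_extension_def matroid_of_rank_def)

lemma indep_add_loops:
  assumes N: "matroid N" and S: "finite S" and disj: "S \<inter> ground N = {}"
  shows "indep (direct_sum N (uniform_matroid 0 S)) = indep N"
proof -
  have "J \<in> indep (direct_sum N (uniform_matroid 0 S)) \<longleftrightarrow> J \<in> indep N" for J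
  proof -
    \<comment> \<open>Since \<open>card\<close> is 0 on infinite sets, finiteness is what makes
      cardinality at most 0 mean empty.\<close>
    have "finite (J \<inter> S)"
      using S by simp
    moreover have "J \<inter> ground N = J" if "J \<subseteq> ground N \<union> S" "J \<inter> S = {}"
      using that by auto
    moreover have "J \<subseteq> ground N" if "J \<in> indep N"
      using that indep_subset_ground[OF N] by blast
    moreover have "J \<inter> S = {}" "J \<inter> ground N = J" if "J \<subseteq> ground N"
      using that disj by auto
    ultimately show ?thesis
      by (auto simp: direct_sum_def uniform_matroid_def)
  qed
  then show ?thesis by blast
qed

lemma ground_principal_sum: "ground (principal_sum M N A B) = ground M \<union> ground N"
  by (auto simp: principal_sum_def matroid_union_def free_extension_def matroid_of_rank_def
      direct_sum_def uniform_matroid_def)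

text \<open>The working criterion. Its inequality bounds the nullity of \<open>Y\<close> by the
  slack of \<open>X\<close> in \<open>X \<union> A\<close>, written without subtraction: whatever of
  \<open>Y\<close> is not covered by an independent set of \<open>N\<close> must lie in
  \<open>B\<close> and be carried by the free extension.\<close>

lemma indep_principal_sum_iff:
  assumes M: "matroid M" and N: "matroid N" and disj: "ground M \<inter> ground N = {}"
    and X: "X \<subseteq> ground M" and Y: "Y \<subseteq> ground N"
  shows "X \<union> Y \<in> indep (principal_sum M N A B) \<longleftrightarrow>
    X \<in> indep M \<and> Y - B \<in> indep N \<and>
    card X + card Y \<le> matroid_rank M (X \<union> A) + matroid_rank N Y"
proof -
  have finX: "finite X" and finY: "finite Y"
    using X Y finite_ground[OF M] finite_ground[OF N] finite_subset by auto
  have "X \<union> Y \<in> indep (principal_sum M N A B) \<longleftrightarrow>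
      (\<exists>I J. X \<union> Y = I \<union> J \<and> I \<in> indep (free_extension M (ground N) A B) \<and> J \<in> indep N)"
    by (simp add: principal_sum_def matroid_union_def
        indep_add_loops[OF N finite_ground[OF M] disj])
  also have "\<dots> \<longleftrightarrow> X \<in> indep M \<and> Y - B \<in> indep N \<and>
    card X + card Y \<le> matroid_rank M (X \<union> A) + matroid_rank N Y" (is "?L \<longleftrightarrow> ?R")
  proof
    assume ?L
    then obtain I J where IJ: "X \<union> Y = I \<union> J" and I: "I \<in> indep (free_extension M (ground N) A B)"
      and J: "J \<in> indep N"
      by blast
    note I = I[unfolded indep_free_extension[OF M finite_ground[OF N] disj]]
    have JN: "J \<subseteq> ground N"
      using J indep_subset_ground[OF N] by blast
    have IX: "I \<inter> ground M = X"
      using IJ JN X Y disj by blast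
    have IY: "(I \<inter> ground N) \<union> J = Y"
      using IJ JN X Y I disj by blast
    have "card (X \<union> (I \<inter> ground N)) = card X + card (I \<inter> ground N)"
      using finX finite_ground[OF N] X disj by (intro card_Un_disjoint) auto
    moreover have "X \<union> (I \<inter> ground N) = I"
      using I IX by blast
    ultimately have "card I = card X + card (I \<inter> ground N)"
      by simp
    moreover have "card Y \<le> card (I \<inter> ground N) + card J"
      using IY card_Un_le by metis
    moreover have "card J \<le> matroid_rank N Y"
      using J IY card_le_rank[OF N] by blast
    moreover have "Y - B \<subseteq> J"
      using I IY by blast
    ultimately show ?R
      using I IX indep_subset[OF N J] by auto
  next
    assume R: ?R
    \<comment> \<open>Starting the basis of \<open>Y\<close> from \<open>Y - B\<close> leaves a
      remainder \<open>Y - J\<close> inside \<open>B\<close> whose size is exactly the nullity of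
      \<open>Y\<close>.\<close>
    then obtain J where J: "J \<in> indep N" "Y - B \<subseteq> J" "J \<subseteq> Y" "card J = matroid_rank N Y"
      using extend_to_basis[OF N, of "Y - B" Y] by blast
    let ?I = "X \<union> (Y - J)"
    have "card ?I = card X + card (Y - J)"
      using X Y disj finX finY by (intro card_Un_disjoint) auto
    also have "card (Y - J) = card Y - card J"
      using J finY by (meson card_Diff_subset finite_subset)
    finally have "card ?I \<le> matroid_rank M (X \<union> A)"
      using R J card_mono[OF finY J(3)] by linarith
    moreover have "?I \<inter> ground M = X" "?I \<inter> ground N \<subseteq> B"
      using X Y J disj by auto
    ultimately have "?I \<in> indep (free_extension M (ground N) A B)"
      using R X Y indep_free_extension[OF M finite_ground[OF N] disj, of ?I A B] by auto
    moreover have "X \<union> Y = ?I \<union> J"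
      using J by blast
    ultimately show ?L
      using J by blast
  qed
  finally show ?thesis .
qed

lemma indep_principal_sum_subset:
  assumes "matroid M" "matroid N" "ground M \<inter> ground N = {}"
    and "Z \<in> indep (principal_sum M N A B)"
  shows "Z \<subseteq> ground M \<union> ground N"
proof -
  obtain I J where "Z = I \<union> J" "I \<in> indep (free_extension M (ground N) A B)" "J \<in> indep N"
    using assms(4) indep_add_loops[OF assms(2) finite_ground[OF assms(1)] assms(3)]
    by (auto simp: principal_sum_def matroid_union_def)
  then show ?thesis
    using indep_subset_ground[OF assms(2)]
    by (auto simp: free_extension_def matroid_of_rank_def)
qed

text \<open>The criterion involves \<open>A\<close> and \<open>B\<close> only through these two
  families of conditions.\<close>

lemma principal_sum_eqI:
  assumes M: "matroid M" and N: "matroid N" and disj: "ground M \<inter> ground N = {}"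
    and rank: "\<And>X. matroid_rank M (X \<union> A) = matroid_rank M (X \<union> A')"
    and indep: "\<And>Y. Y - B \<in> indep N \<longleftrightarrow> Y - B' \<in> indep N"
  shows "principal_sum M N A B = principal_sum M N A' B'"
proof -
  have "Z \<in> indep (principal_sum M N A B) \<longleftrightarrow> Z \<in> indep (principal_sum M N A' B')"
    if Z: "Z \<subseteq> ground M \<union> ground N" for Z
  proof -
    have "Z = (Z \<inter> ground M) \<union> (Z \<inter> ground N)"
      using Z by blast
    then show ?thesis
      using indep_principal_sum_iff[OF M N disj, of "Z \<inter> ground M" "Z \<inter> ground N"] rank indep
      by (metis inf_le2)
  qed
  then have "indep (principal_sum M N A B) = indep (principal_sum M N A' B')"
    using indep_principal_sum_subset[OF M N disj] by (intro set_eqI) metis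
  then show ?thesis
    by (simp add: ground_principal_sum)
qed

section \<open>Recovering the closures from a proper principal sum\<close>

text \<open>A set separating the two sums has a dependent part in \<open>N\<close> whose elements
  outside \<open>B\<close> are independent. Shrinking that part to a basis plus one element gives
  nullity exactly one.\<close>

lemma principal_sum_neq_direct_sumE:
  assumes M: "matroid M" and N: "matroid N" and disj: "ground M \<inter> ground N = {}"
    and neq: "principal_sum M N A B \<noteq> direct_sum M N"
  obtains Y where "0 < matroid_rank M A" "Y \<subseteq> ground N" "Y \<notin> indep N" "Y - B \<in> indep N"
    "card Y = Suc (matroid_rank N Y)"
proof -
  have "indep (principal_sum M N A B) \<noteq> indep (direct_sum M N)"
    using neq by (auto simp: ground_principal_sum direct_sum_def)
  then obtain Z where Z: "Z \<in> indep (principal_sum M N A B) \<longleftrightarrow> Z \<notin> indep (direct_sum M N)"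
    by blast
  let ?X = "Z \<inter> ground M" and ?Y = "Z \<inter> ground N"
  have "Z \<subseteq> ground M \<union> ground N"
    using Z indep_principal_sum_subset[OF M N disj] by (auto simp: direct_sum_def)
  then have "Z = ?X \<union> ?Y" and direct: "Z \<in> indep (direct_sum M N) \<longleftrightarrow> ?X \<in> indep M \<and> ?Y \<in> indep N"
    by (auto simp: direct_sum_def)
  then have sum: "Z \<in> indep (principal_sum M N A B) \<longleftrightarrow> ?X \<in> indep M \<and> ?Y - B \<in> indep N \<and>
      card ?X + card ?Y \<le> matroid_rank M (?X \<union> A) + matroid_rank N ?Y"
    using indep_principal_sum_iff[OF M N disj, of ?X ?Y A B] by simp
  \<comment> \<open>Every independent set of the direct sum is independent in the principal sum, so
    \<open>Z\<close> is independent in the principal sum only.\<close>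
  have "Z \<in> indep (principal_sum M N A B)" if "?X \<in> indep M" "?Y \<in> indep N"
    using that sum indep_subset[OF N that(2) Diff_subset, of B] rank_indep[OF M that(1)] rank_indep[OF N that(2)]
      rank_mono[OF M, of ?X "?X \<union> A"] by auto
  then have X: "?X \<in> indep M" and YB: "?Y - B \<in> indep N" and Y: "?Y \<notin> indep N"
    and card: "card ?X + card ?Y \<le> matroid_rank M (?X \<union> A) + matroid_rank N ?Y"
    using Z direct sum by blast+
  have finY: "finite ?Y"
    using finite_ground[OF N] by simp
  have pos: "0 < matroid_rank M A"
  proof (rule ccontr)
    assume "\<not> 0 < matroid_rank M A"
    \<comment> \<open>If \<open>A\<close> had rank 0, no independent set would meet it;
      \<open>?X\<close> would have no slack and \<open>?Y\<close> would have nullity 0.\<close>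
    then have "matroid_rank M (?X \<union> A) \<le> card ?X"
    proof -
      obtain I where I: "I \<in> indep M" "I \<subseteq> ?X \<union> A" "card I = matroid_rank M (?X \<union> A)"
        using rank_attained[OF M] by blast
      have "card (I \<inter> A) \<le> matroid_rank M A"
        using I indep_subset[OF M] by (intro card_le_rank[OF M]) auto
      then have "I \<inter> A = {}"
        using \<open>\<not> 0 < matroid_rank M A\<close> indep_finite[OF M I(1)] by simp
      then have "I \<subseteq> ?X"
        using I by blast
      then show ?thesis
        using I card_mono[OF indep_finite[OF M X]] by metis
    qed
    then have "card ?Y = matroid_rank N ?Y"
      using card rank_le_card[OF N finY] by linarith
    then show False
      using Y indep_if_rank_eq_card[OF N finY] by simp
  qed
  obtain J where J: "J \<in> indep N" "?Y - B \<subseteq> J" "J \<subseteq> ?Y" "card J = matroid_rank N ?Y"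
    using extend_to_basis[OF N YB] by blast
  have "J \<noteq> ?Y"
    using J Y by metis
  \<comment> \<open>As \<open>J\<close> contains \<open>?Y - B\<close>, this \<open>e\<close> lies
    in \<open>B\<close>, so adding it leaves the part outside \<open>B\<close> unchanged.\<close>
  then obtain e where e: "e \<in> ?Y" "e \<notin> J"
    using J by blast
  have finJ: "finite J"
    using indep_finite[OF N J(1)] .
  have "card (insert e J) = Suc (card J)"
    using e finJ by simp
  moreover have "insert e J \<subseteq> ?Y"
    using e J by blast
  ultimately have notin: "insert e J \<notin> indep N"
    using J card_le_rank[OF N, of "insert e J" ?Y] by auto
  have "card J \<le> matroid_rank N (insert e J)"
    using J by (intro card_le_rank[OF N]) auto
  moreover have "matroid_rank N (insert e J) \<noteq> card (insert e J)"
    using notin indep_if_rank_eq_card[OF N] finJ by blast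
  moreover have "matroid_rank N (insert e J) \<le> card (insert e J)"
    using rank_le_card[OF N] finJ by simp
  ultimately have "card (insert e J) = Suc (matroid_rank N (insert e J))"
    using e finJ by simp
  moreover have "insert e J - B \<in> indep N"
    using J e by (intro indep_subset[OF N J(1)]) auto
  moreover have "insert e J \<subseteq> ground N"
    using J e by blast
  ultimately show thesis
    using that[OF pos] notin by blast
qed

text \<open>Adding one element to an independent set gives nullity at most one, which the positive
  rank of \<open>A\<close> tolerates when the part in \<open>M\<close> is empty. The right-hand side
  sees \<open>A\<close> and \<open>B\<close> only through the principal sum, so equal sums yield
  equal dual closures.\<close>

lemma dual_closure_iff_indep_principal_sum:
  assumes M: "matroid M" and N: "matroid N" and disj: "ground M \<inter> ground N = {}"
    and B: "B \<subseteq> ground N" and rank: "0 < matroid_rank M A"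
  shows "e \<in> matroid_closure (dual_matroid N) B \<longleftrightarrow>
    e \<in> ground N \<and> (\<forall>Y\<in>indep N. insert e Y \<in> indep (principal_sum M N A B))"
proof -
  have "insert e Y \<in> indep (principal_sum M N A B) \<longleftrightarrow> insert e Y - B \<in> indep N"
    if e: "e \<in> ground N" and Y: "Y \<in> indep N" for Y
  proof -
    have "card (insert e Y) \<le> Suc (card Y)"
      by (rule card_insert_le_m1) auto
    moreover have "card Y \<le> matroid_rank N (insert e Y)"
      using Y by (intro card_le_rank[OF N]) auto
    ultimately show ?thesis
      using indep_principal_sum_iff[OF M N disj, of "{}" "insert e Y" A B] e rank
        indep_subset_ground[OF N Y] empty_indep[OF M] by auto
  qed
  then show ?thesis
    using dual_closure_iff[OF N B] by blast
qed

lemma closure_subset_if_principal_sum_eq: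
  assumes M: "matroid M" and N: "matroid N" and disj: "ground M \<inter> ground N = {}"
    and A': "A' \<subseteq> ground M"
    and neq: "principal_sum M N A B \<noteq> direct_sum M N"
    and eq: "principal_sum M N A B = principal_sum M N A' B'"
  shows "matroid_closure M A' \<subseteq> matroid_closure M A"
proof -
  \<comment> \<open>The test set is taken for \<open>B'\<close>, so that in the sum for
    \<open>A'\<close> and \<open>B'\<close> only the inequality can fail.\<close>
  obtain Y where Y: "Y \<subseteq> ground N" "Y - B' \<in> indep N" "card Y = Suc (matroid_rank N Y)"
    using principal_sum_neq_direct_sumE[OF M N disj, of A' B'] neq eq by metis
  obtain I where I: "I \<in> indep M" "I \<subseteq> A" "card I = matroid_rank M A"
    using rank_attained[OF M] by blast
  note IM = indep_subset_ground[OF M I(1)]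
  \<comment> \<open>A basis \<open>I\<close> of \<open>A\<close> has no slack, so it cannot absorb
    nullity one. By equality of the sums it has no slack over \<open>A'\<close> either, which puts
    \<open>A'\<close> into the closure of \<open>I\<close>.\<close>
  have "I \<union> Y \<notin> indep (principal_sum M N A B)"
    using indep_principal_sum_iff[OF M N disj IM Y(1)] I Y by (simp add: Un_absorb1)
  then have "matroid_rank M (I \<union> A') \<le> card I"
    using indep_principal_sum_iff[OF M N disj IM Y(1), of A' B'] I Y eq by simp
  moreover have "card I \<le> matroid_rank M (insert e I)" for e
    using I by (intro card_le_rank[OF M]) auto
  moreover have "matroid_rank M (insert e I) \<le> matroid_rank M (I \<union> A')" if "e \<in> A'" for e
    using that by (intro rank_mono[OF M]) auto
  ultimately have "A' \<subseteq> matroid_closure M I"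
    using A' rank_indep[OF M I(1)] by (auto simp: matroid_closure_def intro: antisym le_trans)
  then have "matroid_rank M (A \<union> I \<union> A') = matroid_rank M (A \<union> I)"
    by (intro rank_union_closure[OF M]) auto
  then have "matroid_rank M (A \<union> A') = matroid_rank M A"
    using I(2) by (simp add: Un_absorb2)
  then show ?thesis
    by (rule closure_subset_if_rank_union_eq[OF M A'])
qed

theorem theorem3p19:
  fixes M N :: "'a indep_system" and A A' B B' :: "'a set"
  assumes "matroid M" and "matroid N"
    and "ground M \<inter> ground N = {}"
    and "A \<subseteq> ground M" and "A' \<subseteq> ground M"
    and "B \<subseteq> ground N" and "B' \<subseteq> ground N"
  shows "(matroid_closure M A = matroid_closure M A' \<and> matroid_closure (dual_matroid N) B = matroid_closure (dual_matroid N) B' \<longrightarrow>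
            principal_sum M N A B = principal_sum M N A' B') \<and>
         (principal_sum M N A B \<noteq> direct_sum M N \<and>
          principal_sum M N A B = principal_sum M N A' B' \<longrightarrow>
            matroid_closure M A = matroid_closure M A' \<and> matroid_closure (dual_matroid N) B = matroid_closure (dual_matroid N) B')"
proof (intro conjI[OF impI impI]; elim conjE)
  assume A: "matroid_closure M A = matroid_closure M A'"
    and B: "matroid_closure (dual_matroid N) B = matroid_closure (dual_matroid N) B'"
  show "principal_sum M N A B = principal_sum M N A' B'"
  proof (rule principal_sum_eqI[OF assms(1-3)])
    show "matroid_rank M (X \<union> A) = matroid_rank M (X \<union> A')" for X
      by (rule rank_union_eq_if_closure_eq[OF assms(1,4,5) A])
    show "Y - B \<in> indep N \<longleftrightarrow> Y - B' \<in> indep N" for Y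
      using indep_diff_dual_closure_iff[OF assms(2,6), of Y]
        indep_diff_dual_closure_iff[OF assms(2,7), of Y] B by simp
  qed
next
  assume neq: "principal_sum M N A B \<noteq> direct_sum M N"
    and eq: "principal_sum M N A B = principal_sum M N A' B'"
  \<comment> \<open>Both pairs now satisfy the same assumptions, so the reverse inclusion and the
    positivity for \<open>A'\<close> follow by symmetry.\<close>
  then have neq': "principal_sum M N A' B' \<noteq> direct_sum M N"
    by simp
  have pos: "0 < matroid_rank M A"
    using principal_sum_neq_direct_sumE[OF assms(1-3) neq] .
  have pos': "0 < matroid_rank M A'"
    using principal_sum_neq_direct_sumE[OF assms(1-3) neq'] .
  show "matroid_closure M A = matroid_closure M A' \<and>
    matroid_closure (dual_matroid N) B = matroid_closure (dual_matroid N) B'"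
  proof
    show "matroid_closure M A = matroid_closure M A'"
      by (intro subset_antisym closure_subset_if_principal_sum_eq[OF assms(1-3,4) neq' eq[symmetric]]
          closure_subset_if_principal_sum_eq[OF assms(1-3,5) neq eq])
    have "e \<in> matroid_closure (dual_matroid N) B \<longleftrightarrow> e \<in> matroid_closure (dual_matroid N) B'" for e
      unfolding dual_closure_iff_indep_principal_sum[OF assms(1-3,6) pos]
        dual_closure_iff_indep_principal_sum[OF assms(1-3,7) pos'] eq by (rule refl)
    then show "matroid_closure (dual_matroid N) B = matroid_closure (dual_matroid N) B'"
      by (rule set_eqI)
  qed
qed

end
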